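(* Let $n\geq 1$ and let $F(n;p)$ denote the number of $\alpha\in\mathcal{DDP}_n$ with $h(\alpha)=p$. (1) If $n$ is odd and $(n+1)/2\geq p\geq 2$, then $$F(n;p)=\frac{(n+1)(n-1)(n-3)\cdots(n-2p+3)\,(2n-3p+3)}{2^p(p+1)!}+\binom{n+1}{p+1}.$$ (2) If $n$ is even and $n/2\geq p\geq 2$, then $$F(n;p)=\frac{n(n-2)(n-4)\cdots(n-2p+2)\,(2n-p+3)}{2^p(p+1)!}+\binom{n+1}{p+1}.$$ (3) If $\lfloor (n+1)/2\rfloor<p$, then $F(n;p)=\binom{n+1}{p+1}$. Here $(n+1)(n-1)\cdots(n-2p+3)=\prod_{j=0}^{p-1}(n+1-2j)$ and $n(n-2)\cdots(n-2p+2)=\prod_{j=0}^{p-1}(n-2j)$.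
   Context: $X_n=\{1,2,\ldots,n\}$ and $\mathcal{I}_n$ is the symmetric inverse semigroup of all partial one-to-one maps of $X_n$ (including the empty map), with maps written on the right of their arguments. A map $\alpha\in\mathcal{I}_n$ is a partial isometry if $|x-y|=|x\alpha-y\alpha|$ for all $x,y\in\operatorname{Dom}\alpha$; it is order-decreasing if $x\alpha\leq x$ for all $x\in\operatorname{Dom}\alpha$. $\mathcal{DDP}_n$ is the semigroup of all order-decreasing partial isometries of $X_n$. The height of $\alpha$ is $h(\alpha)=|\operatorname{Im}\alpha|$. *)

theory Defs
  imports Complex_Main
begin

text \<open>A partial map on \<open>{1..n}\<close> is represented as a map \<open>nat \<rightharpoonup> nat\<close> that is undefined outside
  \<open>{1..n}\<close>, so distinct partial maps are distinct as functions.\<close>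

definition sym_inv_semigroup :: "nat \<Rightarrow> (nat \<rightharpoonup> nat) set" where
  "sym_inv_semigroup n =
     {\<alpha>. dom \<alpha> \<subseteq> {1..n} \<and> ran \<alpha> \<subseteq> {1..n} \<and> inj_on \<alpha> (dom \<alpha>)}"

definition partial_isometry :: "(nat \<rightharpoonup> nat) \<Rightarrow> bool" where
  "partial_isometry \<alpha> \<longleftrightarrow>
     (\<forall>x\<in>dom \<alpha>. \<forall>y\<in>dom \<alpha>. \<bar>int x - int y\<bar> = \<bar>int (the (\<alpha> x)) - int (the (\<alpha> y))\<bar>)"

definition order_decreasing :: "(nat \<rightharpoonup> nat) \<Rightarrow> bool" where
  "order_decreasing \<alpha> \<longleftrightarrow> (\<forall>x\<in>dom \<alpha>. the (\<alpha> x) \<le> x)"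

definition DDP :: "nat \<Rightarrow> (nat \<rightharpoonup> nat) set" where
  "DDP n = {\<alpha> \<in> sym_inv_semigroup n. partial_isometry \<alpha> \<and> order_decreasing \<alpha>}"

definition height :: "(nat \<rightharpoonup> nat) \<Rightarrow> nat" where
  "height \<alpha> = card (ran \<alpha>)"

definition F :: "nat \<Rightarrow> nat \<Rightarrow> nat" where
  "F n p = card {\<alpha> \<in> DDP n. height \<alpha> = p}"

lemma finite_DDP: "finite (DDP n)"
proof -
  have "sym_inv_semigroup n \<subseteq> (\<Union>A\<in>Pow {1..n}. {\<alpha>. dom \<alpha> = A \<and> ran \<alpha> \<subseteq> {1..n}})"
    unfolding sym_inv_semigroup_def by auto
  moreover have "finite (\<Union>A\<in>Pow {1..n}. {\<alpha>. dom \<alpha> = A \<and> ran \<alpha> \<subseteq> {1..n::nat}})"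
    by (intro finite_UN_I finite_set_of_finite_maps) (auto intro: finite_subset)
  ultimately show ?thesis
    unfolding DDP_def by (auto intro: finite_subset)
qed

end

theory Submission
  imports Defs
begin

text \<open>A partial isometry of the integers with at least two points in its domain is the restriction
  of exactly one isometry of the line: either a translation \<open>x \<mapsto> x - k\<close> or a reflection
  \<open>x \<mapsto> s - x\<close> (lemma \<open>isometry_cases\<close>; two distinct points tell the two kinds apart because one
  keeps their order and the other reverses it). Counting the order-decreasing partial isometries
  of height \<open>p \<ge> 2\<close> therefore means counting pairs of a parameter and a \<open>p\<close>-element domain, and for
  each parameter the admissible points form an interval:

  \<^item> the translation by \<open>k \<ge> 0\<close> is admissible on \<open>{k+1..n}\<close>, so translations contribute
    \<open>\<Sum>k<n. (n-k) choose p\<close>, which is \<open>(n+1) choose (p+1)\<close> by the hockey-stick identity;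

  \<^item> the reflection \<open>x \<mapsto> s - x\<close> needs \<open>1 \<le> s - x \<le> x \<le> n\<close>, that is
    \<open>\<lceil>s/2\<rceil> \<le> x \<le> min n (s-1)\<close>. For \<open>s = 2t\<close> this interval has \<open>min t (n+1-t)\<close> points, and
    for \<open>s = 2t+1\<close> it has \<open>min t (n-t)\<close> points.

  Hence each parity class of \<open>s\<close> gives a tent-shaped sum, and cutting a tent at its peak leaves two
  hockey-stick sums (lemma \<open>sum_tent_choose\<close>). With \<open>h = (n+1) div 2\<close> and \<open>g = n div 2\<close> the result
  \<open>F_closed_form\<close> is, writing \<open>C(a)\<close> for \<open>a choose (p+1)\<close>,
  \<open>F n p = C(n+1) + C(h+1) + 2 C(g+1) + C(h)\<close>, for every parity of \<open>n\<close>. The last three terms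
  vanish when \<open>p > h\<close>; otherwise \<open>a choose p = a(a-1)\<cdots>(a-p+1)/p!\<close> turns them into the two product
  formulas.\<close>


section \<open>Translations and reflections\<close>

text \<open>Both formulas use truncated subtraction. The parameter sets \<open>shift_data\<close> and
  \<open>reflect_data\<close> below only admit domains on which every value is positive, and there the
  subtraction is the integer one.\<close>

definition shift_on :: "nat \<times> nat set \<Rightarrow> (nat \<rightharpoonup> nat)" where
  "shift_on = (\<lambda>(k, A). (\<lambda>x. Some (x - k)) |` A)"

definition reflect_on :: "nat \<times> nat set \<Rightarrow> (nat \<rightharpoonup> nat)" where
  "reflect_on = (\<lambda>(s, A). (\<lambda>x. Some (s - x)) |` A)"

lemma dom_shift_on [simp]: "dom (shift_on (k, A)) = A"
  by (auto simp: shift_on_def)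

lemma dom_reflect_on [simp]: "dom (reflect_on (s, A)) = A"
  by (auto simp: reflect_on_def)

lemma the_shift_on [simp]: "x \<in> A \<Longrightarrow> the (shift_on (k, A) x) = x - k"
  by (simp add: shift_on_def)

lemma the_reflect_on [simp]: "x \<in> A \<Longrightarrow> the (reflect_on (s, A) x) = s - x"
  by (simp add: reflect_on_def)

definition shift_data :: "nat \<Rightarrow> nat \<Rightarrow> (nat \<times> nat set) set" where
  "shift_data n p = (SIGMA k:{..<n}. {A. A \<subseteq> {k+1..n} \<and> card A = p})"

text \<open>Halving with \<open>(s + 1) div 2\<close> rounds up: it is the least \<open>x\<close> with \<open>s - x \<le> x\<close>.\<close>

definition reflect_data :: "nat \<Rightarrow> nat \<Rightarrow> (nat \<times> nat set) set" where
  "reflect_data n p =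
     (SIGMA s:{2..2*n}. {A. A \<subseteq> {(s + 1) div 2..min n (s - 1)} \<and> card A = p})"

text \<open>The image of a third point is determined by its distances to the images of \<open>a\<close> and \<open>b\<close>, so
  the slope between \<open>a\<close> and \<open>b\<close>, which is \<open>1\<close> or \<open>-1\<close>, propagates to the whole set.\<close>

lemma isometry_cases:
  fixes f :: "int \<Rightarrow> int"
  assumes iso: "\<And>x y. x \<in> D \<Longrightarrow> y \<in> D \<Longrightarrow> \<bar>x - y\<bar> = \<bar>f x - f y\<bar>"
    and ab: "a \<in> D" "b \<in> D" "a \<noteq> b"
  shows "(\<exists>c. \<forall>x\<in>D. f x = x - c) \<or> (\<exists>c. \<forall>x\<in>D. f x = c - x)"
proof -
  have "f b - f a = b - a \<or> f b - f a = a - b"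
    using iso[OF ab(1,2)] by linarith
  then show ?thesis
  proof
    assume *: "f b - f a = b - a"
    have "f x = x - (a - f a)" if "x \<in> D" for x
      using iso[OF that ab(1)] iso[OF that ab(2)] * ab(3) by linarith
    then show ?thesis by blast
  next
    assume *: "f b - f a = a - b"
    have "f x = (a + f a) - x" if "x \<in> D" for x
      using iso[OF that ab(1)] iso[OF that ab(2)] * ab(3) by linarith
    then show ?thesis by blast
  qed
qed

lemma partial_map_eqI:
  assumes "dom \<alpha> = dom \<beta>" "\<And>x. x \<in> dom \<alpha> \<Longrightarrow> the (\<alpha> x) = the (\<beta> x)"
  shows "\<alpha> = \<beta>"
proof
  fix x
  show "\<alpha> x = \<beta> x"
  proof (cases "x \<in> dom \<alpha>")
    case True
    then have "x \<in> dom \<beta>" using assms(1) by simp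
    then show ?thesis using assms(2)[OF True] True by fastforce
  next
    case False
    then show ?thesis using assms(1) by (metis domIff)
  qed
qed

lemma ran_eq_image_the: "ran \<alpha> = (\<lambda>x. the (\<alpha> x)) ` dom \<alpha>"
  by (force simp: ran_def dom_def)

text \<open>Distance preservation already forces injectivity, so membership in \<open>DDP n\<close> is a pointwise
  condition on values together with the isometry condition.\<close>

lemma DDP_iff:
  "\<alpha> \<in> DDP n \<longleftrightarrow> dom \<alpha> \<subseteq> {1..n} \<and> (\<forall>x\<in>dom \<alpha>. 1 \<le> the (\<alpha> x) \<and> the (\<alpha> x) \<le> x)
     \<and> partial_isometry \<alpha>"
proof -
  have "inj_on \<alpha> (dom \<alpha>)" if "partial_isometry \<alpha>"
  proof (rule inj_onI)
    fix x y assume "x \<in> dom \<alpha>" "y \<in> dom \<alpha>" "\<alpha> x = \<alpha> y"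
    then show "x = y" using that by (force simp: partial_isometry_def)
  qed
  moreover have "ran \<alpha> \<subseteq> {1..n} \<longleftrightarrow> (\<forall>x\<in>dom \<alpha>. 1 \<le> the (\<alpha> x) \<and> the (\<alpha> x) \<le> n)"
    unfolding ran_eq_image_the image_subset_iff by simp
  moreover have "the (\<alpha> x) \<le> n" if "dom \<alpha> \<subseteq> {1..n}" "x \<in> dom \<alpha>" "the (\<alpha> x) \<le> x" for x
    using that by (meson atLeastAtMost_iff le_trans subsetD)
  ultimately show ?thesis
    unfolding DDP_def sym_inv_semigroup_def order_decreasing_def mem_Collect_eq by blast
qed

lemma height_DDP:
  assumes "\<alpha> \<in> DDP n"
  shows "height \<alpha> = card (dom \<alpha>)"
proof -
  have "inj_on (\<lambda>x. the (\<alpha> x)) (dom \<alpha>)"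
  proof (rule inj_onI)
    fix x y assume "x \<in> dom \<alpha>" "y \<in> dom \<alpha>" "the (\<alpha> x) = the (\<alpha> y)"
    then show "x = y" using assms by (force simp: DDP_iff partial_isometry_def)
  qed
  then show ?thesis by (simp add: height_def ran_eq_image_the card_image)
qed

lemma shift_on_in_DDP:
  assumes "A \<subseteq> {k+1..n}"
  shows "shift_on (k, A) \<in> DDP n"
proof -
  have x: "k < x \<and> x \<le> n" if "x \<in> A" for x using that assms by auto
  then have "partial_isometry (shift_on (k, A))"
    by (simp add: partial_isometry_def of_nat_diff less_imp_le)
  moreover have "1 \<le> x \<and> 1 \<le> x - k" if "x \<in> A" for x using x[OF that] by linarith
  ultimately show ?thesis
    using x by (auto simp: DDP_iff)
qed

lemma reflect_on_in_DDP:
  assumes "A \<subseteq> {(s + 1) div 2..min n (s - 1)}" "2 \<le> s"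
  shows "reflect_on (s, A) \<in> DDP n"
proof -
  have x: "1 \<le> x \<and> x \<le> n \<and> x < s \<and> s - x \<le> x" if "x \<in> A" for x
  proof -
    have "(s + 1) div 2 \<le> x \<and> x \<le> n \<and> x \<le> s - 1" using that assms(1) by auto
    then show ?thesis using assms(2) by linarith
  qed
  have "partial_isometry (reflect_on (s, A))"
    unfolding partial_isometry_def
  proof (intro ballI)
    fix a b assume "a \<in> dom (reflect_on (s, A))" "b \<in> dom (reflect_on (s, A))"
    then have "a \<in> A" "b \<in> A" by simp_all
    then show "\<bar>int a - int b\<bar> = \<bar>int (the (reflect_on (s, A) a)) - int (the (reflect_on (s, A) b))\<bar>"
      using x[of a] x[of b] by (simp add: of_nat_diff less_imp_le)
  qed
  then show ?thesis
    using x by (auto simp: DDP_iff Suc_le_eq)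
qed

lemma two_distinct_elements:
  assumes "card A = p" "p \<ge> 2"
  obtains x y where "x \<in> A" "y \<in> A" "(x::nat) < y"
proof -
  have "\<not> is_singleton A" "A \<noteq> {}"
    using assms by (auto simp: is_singleton_altdef)
  then obtain x y where "x \<in> A" "y \<in> A" "x \<noteq> y"
    by (metis is_singletonI')
  then show thesis using that by (metis linorder_neqE_nat)
qed

text \<open>The bound \<open>p \<ge> 2\<close> supplies the two points that \<open>isometry_cases\<close> needs. One of them also
  confines the parameter to the finite range used in the data sets.\<close>

lemma DDP_height_eq:
  assumes "p \<ge> 2"
  shows "{\<alpha> \<in> DDP n. height \<alpha> = p}
           = shift_on ` shift_data n p \<union> reflect_on ` reflect_data n p"
proof (intro equalityI subsetI)
  fix \<alpha> assume "\<alpha> \<in> {\<alpha> \<in> DDP n. height \<alpha> = p}"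
  then have \<alpha>: "\<alpha> \<in> DDP n" and card: "card (dom \<alpha>) = p"
    using height_DDP by auto
  have in_range: "1 \<le> x \<and> x \<le> n \<and> 1 \<le> the (\<alpha> x) \<and> the (\<alpha> x) \<le> x" if "x \<in> dom \<alpha>" for x
    using \<alpha> that unfolding DDP_iff by (meson atLeastAtMost_iff subsetD)
  obtain a b where ab: "a \<in> dom \<alpha>" "b \<in> dom \<alpha>" "a < b"
    using two_distinct_elements[OF card assms] .
  define f where "f = (\<lambda>x. int (the (\<alpha> (nat x))))"
  have f: "f (int x) = int (the (\<alpha> x))" for x by (simp add: f_def)
  have "(\<exists>c. \<forall>x\<in>int ` dom \<alpha>. f x = x - c) \<or> (\<exists>c. \<forall>x\<in>int ` dom \<alpha>. f x = c - x)"
  proof (rule isometry_cases)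
    fix x y assume "x \<in> int ` dom \<alpha>" "y \<in> int ` dom \<alpha>"
    then show "\<bar>x - y\<bar> = \<bar>f x - f y\<bar>"
      using \<alpha> unfolding DDP_iff partial_isometry_def by (elim imageE) (simp only: f)
  next
    show "int a \<in> int ` dom \<alpha>" "int b \<in> int ` dom \<alpha>" "int a \<noteq> int b" using ab by auto
  qed
  then show "\<alpha> \<in> shift_on ` shift_data n p \<union> reflect_on ` reflect_data n p"
  proof (elim disjE exE)
    fix c assume "\<forall>x\<in>int ` dom \<alpha>. f x = x - c"
    then have c: "int (the (\<alpha> x)) = int x - c" if "x \<in> dom \<alpha>" for x
      using f that by auto
    define k where "k = nat c"
    have "c \<ge> 0" using c[OF ab(1)] in_range[OF ab(1)] by linarith
    then have k: "the (\<alpha> x) = x - k \<and> k + 1 \<le> x" if "x \<in> dom \<alpha>" for x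
      using c[OF that] in_range[OF that] unfolding k_def by linarith
    have "k < n" using k[OF ab(1)] in_range[OF ab(1)] by linarith
    moreover have "dom \<alpha> \<subseteq> {k+1..n}"
      unfolding subset_iff atLeastAtMost_iff using k in_range by blast
    ultimately have "(k, dom \<alpha>) \<in> shift_data n p"
      using card by (simp add: shift_data_def)
    moreover have "\<alpha> = shift_on (k, dom \<alpha>)"
      by (rule partial_map_eqI) (use k in simp_all)
    ultimately show ?thesis by blast
  next
    fix c assume "\<forall>x\<in>int ` dom \<alpha>. f x = c - x"
    then have c: "int (the (\<alpha> x)) = c - int x" if "x \<in> dom \<alpha>" for x
      using f that by auto
    define s where "s = nat c"
    have "c \<ge> 0" using c[OF ab(1)] in_range[OF ab(1)] by linarith
    then have s: "the (\<alpha> x) = s - x \<and> x + 1 \<le> s \<and> s \<le> 2 * x" if "x \<in> dom \<alpha>" for x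
      using c[OF that] in_range[OF that] unfolding s_def by linarith
    have "s \<in> {2..2*n}" using s[OF ab(1)] in_range[OF ab(1)] by auto
    moreover have "dom \<alpha> \<subseteq> {(s + 1) div 2..min n (s - 1)}"
    proof
      fix x assume "x \<in> dom \<alpha>"
      then show "x \<in> {(s + 1) div 2..min n (s - 1)}"
        using s[of x] in_range[of x] by auto
    qed
    ultimately have "(s, dom \<alpha>) \<in> reflect_data n p"
      using card by (simp add: reflect_data_def)
    moreover have "\<alpha> = reflect_on (s, dom \<alpha>)"
      by (rule partial_map_eqI) (use s in simp_all)
    ultimately show ?thesis by blast
  qed
next
  fix \<alpha> assume "\<alpha> \<in> shift_on ` shift_data n p \<union> reflect_on ` reflect_data n p"
  then show "\<alpha> \<in> {\<alpha> \<in> DDP n. height \<alpha> = p}"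
  proof
    assume "\<alpha> \<in> shift_on ` shift_data n p"
    then obtain k A where A: "A \<subseteq> {k+1..n}" "card A = p" "\<alpha> = shift_on (k, A)"
      by (auto simp: shift_data_def)
    then show ?thesis using shift_on_in_DDP[OF A(1)] height_DDP by simp
  next
    assume "\<alpha> \<in> reflect_on ` reflect_data n p"
    then obtain s A where A: "A \<subseteq> {(s + 1) div 2..min n (s - 1)}" "2 \<le> s" "card A = p"
        "\<alpha> = reflect_on (s, A)"
      by (auto simp: reflect_data_def)
    then show ?thesis using reflect_on_in_DDP[OF A(1,2)] height_DDP by simp
  qed
qed

lemma shift_on_eqD:
  assumes "shift_on (k, A) = shift_on (l, B)"
  shows "A = B" "x \<in> A \<Longrightarrow> x - k = x - l"
  using assms by (metis dom_shift_on, metis dom_shift_on the_shift_on)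

lemma reflect_on_eqD:
  assumes "reflect_on (s, A) = reflect_on (t, B)"
  shows "A = B" "x \<in> A \<Longrightarrow> s - x = t - x"
  using assms by (metis dom_reflect_on, metis dom_reflect_on the_reflect_on)

text \<open>A map determines its domain, and its value at any one point of the domain determines the
  parameter, because that value is positive and so was not truncated.\<close>

lemma inj_on_shift_on:
  assumes "p \<ge> 1"
  shows "inj_on shift_on (shift_data n p)"
proof (rule inj_onI)
  fix u v
  assume uv: "u \<in> shift_data n p" "v \<in> shift_data n p" "shift_on u = shift_on v"
  obtain k A where u: "u = (k, A)" by (cases u)
  obtain l B where v: "v = (l, B)" by (cases v)
  have A: "A \<subseteq> {k+1..n}" "card A = p" and B: "B \<subseteq> {l+1..n}"
    using uv(1,2) by (simp_all add: u v shift_data_def)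
  note eq = shift_on_eqD[OF uv(3)[unfolded u v]]
  have "A \<noteq> {}" using A(2) assms by auto
  then obtain x where x: "x \<in> A" by blast
  have "k < x" "l < x" using subsetD[OF A(1) x] subsetD[OF B, of x] x eq(1) by simp_all
  then show "u = v" using eq(1) eq(2)[OF x] by (simp add: u v)
qed

lemma inj_on_reflect_on:
  assumes "p \<ge> 1"
  shows "inj_on reflect_on (reflect_data n p)"
proof (rule inj_onI)
  fix u v
  assume uv: "u \<in> reflect_data n p" "v \<in> reflect_data n p" "reflect_on u = reflect_on v"
  obtain s A where u: "u = (s, A)" by (cases u)
  obtain t B where v: "v = (t, B)" by (cases v)
  have A: "A \<subseteq> {(s + 1) div 2..min n (s - 1)}" "card A = p" "2 \<le> s"
    and B: "B \<subseteq> {(t + 1) div 2..min n (t - 1)}" "2 \<le> t"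
    using uv(1,2) by (simp_all add: u v reflect_data_def)
  note eq = reflect_on_eqD[OF uv(3)[unfolded u v]]
  have "A \<noteq> {}" using A(2) assms by auto
  then obtain x where x: "x \<in> A" by blast
  have "x \<le> s - 1" "x \<le> t - 1"
    using subsetD[OF A(1) x] subsetD[OF B(1), of x] x eq(1) by simp_all
  then have "s = t" using A(3) B(2) eq(2)[OF x] by linarith
  then show "u = v" using eq(1) by (simp add: u v)
qed

text \<open>A map of both kinds would preserve and reverse the order of two points of its domain.\<close>

lemma shift_reflect_disjoint:
  assumes "p \<ge> 2"
  shows "shift_on ` shift_data n p \<inter> reflect_on ` reflect_data n p = {}"
proof (rule ccontr)
  assume "\<not> ?thesis"
  then obtain u v where uv: "u \<in> shift_data n p" "shift_on u = reflect_on v" by auto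
  obtain k A where u: "u = (k, A)" by (cases u)
  obtain s B where v: "v = (s, B)" by (cases v)
  have A: "A \<subseteq> {k+1..n}" "card A = p"
    using uv(1) by (simp_all add: u shift_data_def)
  have eq: "shift_on (k, A) = reflect_on (s, B)"
    using uv(2) by (simp add: u v)
  have "A = B" using arg_cong[OF eq, of dom] by simp
  obtain x y where xy: "x \<in> A" "y \<in> A" "x < y"
    using two_distinct_elements[OF A(2) assms] .
  have "x - k = s - x" "y - k = s - y"
    using arg_cong[OF eq, of "\<lambda>f. the (f x)"] arg_cong[OF eq, of "\<lambda>f. the (f y)"]
      xy \<open>A = B\<close> by simp_all
  moreover have "k < x" "k < y" using subsetD[OF A(1) xy(1)] subsetD[OF A(1) xy(2)] by simp_all
  ultimately show False using xy(3) by linarith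
qed


section \<open>Summing over the parameters\<close>

text \<open>The term \<open>t = 0\<close> vanishes for \<open>p \<ge> 1\<close>, so the hockey-stick identity may start at \<open>1\<close>.\<close>

lemma sum_choose_from_1:
  assumes "p \<ge> 1"
  shows "(\<Sum>t = 1..h. t choose p) = (h + 1) choose (p + 1)"
proof -
  have "(\<Sum>t = 1..h. t choose p) = (\<Sum>t\<le>h. t choose p)"
    by (rule sum.mono_neutral_left) (use assms in \<open>auto simp: not_le\<close>)
  then show ?thesis using sum_choose_upper[of p h] by simp
qed

text \<open>The tent \<open>t \<mapsto> min t (n+1-t)\<close> rises through \<open>1..(n+1) div 2\<close>; read backwards, its falling part
  runs through \<open>1..n div 2\<close>.\<close>

lemma sum_tent_choose:
  assumes "p \<ge> 1"
  shows "(\<Sum>t = 1..n. min t (n + 1 - t) choose p)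
           = (((n + 1) div 2 + 1) choose (p + 1)) + ((n div 2 + 1) choose (p + 1))"
proof -
  define h where "h = (n + 1) div 2"
  have "{1..n} = {1..h} \<union> {h+1..n}" by (auto simp: h_def)
  then have "(\<Sum>t = 1..n. min t (n + 1 - t) choose p)
      = (\<Sum>t = 1..h. min t (n + 1 - t) choose p) + (\<Sum>t = h+1..n. min t (n + 1 - t) choose p)"
    by (simp add: sum.union_disjoint)
  also have "(\<Sum>t = 1..h. min t (n + 1 - t) choose p) = (\<Sum>t = 1..h. t choose p)"
    by (rule sum.cong) (auto simp: h_def min_def)
  also have "(\<Sum>t = h+1..n. min t (n + 1 - t) choose p) = (\<Sum>t = 1..n div 2. t choose p)"
    by (rule sum.reindex_bij_witness[of _ "\<lambda>t. n + 1 - t" "\<lambda>t. n + 1 - t"])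
       (auto simp: h_def min_def)
  finally show ?thesis by (simp only: sum_choose_from_1[OF assms] h_def)
qed

lemma sum_even_odd:
  fixes f :: "nat \<Rightarrow> nat"
  shows "(\<Sum>s = 2..2*n. f s) = (\<Sum>t = 1..n. f (2 * t)) + (\<Sum>t = 1..n - 1. f (2 * t + 1))"
proof (induction n)
  case (Suc n)
  show ?case
  proof (cases n)
    case (Suc m)
    then show ?thesis using Suc.IH by simp
  qed simp
qed simp

lemma card_shift_data:
  assumes "p \<ge> 1"
  shows "card (shift_data n p) = (n + 1) choose (p + 1)"
proof -
  have "card (shift_data n p) = (\<Sum>k<n. (n - k) choose p)"
    unfolding shift_data_def by (subst card_SigmaI) (auto simp: n_subsets)
  also have "\<dots> = (\<Sum>t = 1..n. t choose p)"
    by (rule sum.reindex_bij_witness[of _ "\<lambda>t. n - t" "\<lambda>t. n - t"]) auto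
  finally show ?thesis using sum_choose_from_1[OF assms] by simp
qed

lemma card_reflect_data:
  assumes "p \<ge> 1"
  shows "card (reflect_data n p) =
    (((n + 1) div 2 + 1) choose (p + 1)) + 2 * ((n div 2 + 1) choose (p + 1))
      + (((n + 1) div 2) choose (p + 1))"
proof -
  define size where "size s = card {(s + 1) div 2..min n (s - 1)}" for s
  have even_size: "size (2 * t) = min t (n + 1 - t)" if "t \<in> {1..n}" for t
    using that by (auto simp: size_def min_def)
  have odd_size: "size (2 * t + 1) = min t (n - t)" for t
    by (auto simp: size_def min_def)
  have "card (reflect_data n p) = (\<Sum>s = 2..2*n. size s choose p)"
    unfolding reflect_data_def size_def by (subst card_SigmaI) (auto simp: n_subsets)
  also have "\<dots> = (\<Sum>t = 1..n. min t (n + 1 - t) choose p) + (\<Sum>t = 1..n - 1. min t (n - t) choose p)"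
    unfolding sum_even_odd by (simp add: even_size odd_size[simplified])
  also have "(\<Sum>t = 1..n - 1. min t (n - t) choose p)
      = ((n div 2 + 1) choose (p + 1)) + (((n + 1) div 2) choose (p + 1))"
  proof (cases n)
    case (Suc m)
    then show ?thesis using sum_tent_choose[OF assms, of m] by simp
  qed (use assms in simp)
  finally show ?thesis using sum_tent_choose[OF assms, of n] by simp
qed

lemma F_closed_form:
  assumes "p \<ge> 2"
  shows "F n p = ((n + 1) choose (p + 1)) +
    ((((n + 1) div 2 + 1) choose (p + 1)) + 2 * ((n div 2 + 1) choose (p + 1))
      + (((n + 1) div 2) choose (p + 1)))"
proof -
  have p: "p \<ge> 1" using assms by simp
  have "finite {\<alpha> \<in> DDP n. height \<alpha> = p}" using finite_DDP by simp
  then have "finite (shift_on ` shift_data n p)" "finite (reflect_on ` reflect_data n p)"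
    unfolding DDP_height_eq[OF assms] by simp_all
  then have "F n p = card (shift_on ` shift_data n p) + card (reflect_on ` reflect_data n p)"
    unfolding F_def DDP_height_eq[OF assms]
    by (rule card_Un_disjoint[OF _ _ shift_reflect_disjoint[OF assms]])
  then show ?thesis
    using inj_on_shift_on[OF p] inj_on_reflect_on[OF p] card_shift_data[OF p]
      card_reflect_data[OF p] by (simp add: card_image)
qed


section \<open>The product formulas\<close>

lemma prod_double_eq_choose:
  "(\<Prod>j<p. 2 * real m - 2 * real j) = 2 ^ p * fact p * real (m choose p)"
proof -
  have "(\<Prod>j<p. 2 * real m - 2 * real j) = (\<Prod>j<p. 2 * (real m - real j))"
    by (simp only: right_diff_distrib)
  also have "\<dots> = 2 ^ p * (\<Prod>j<p. real m - real j)"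
    by (simp only: prod.distrib prod_constant card_lessThan)
  also have "(\<Prod>j<p. real m - real j) = fact p * real (m choose p)"
    by (simp add: binomial_gbinomial gbinomial_prod_rev atLeast0LessThan)
  finally show ?thesis by simp
qed

lemma choose_Suc_ratio:
  "real (m choose (p + 1)) = real (m choose p) * (real m - real p) / (real p + 1)"
proof -
  have "Suc m * (m choose p) = ((m choose p) + (m choose (p + 1))) * Suc p"
    using Suc_times_binomial_eq[of m p] by simp
  then have "real (Suc m * (m choose p)) = real (((m choose p) + (m choose (p + 1))) * Suc p)"
    by (rule arg_cong)
  then show ?thesis by (simp add: field_simps)
qed

text \<open>All terms are multiples of \<open>m choose p\<close>, and the linear factor collects the coefficients: in
  \<open>c (m choose (p+1)) + d (m choose p)\<close> it is \<open>c (m - p) + d (p + 1)\<close>.\<close>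

lemma choose_combination_eq_prod:
  "(\<Prod>j<p. 2 * real m - 2 * real j) * (c * (real m - real p) + d * (real p + 1))
       / (2 ^ p * fact (p + 1))
     = c * real (m choose (p + 1)) + d * real (m choose p)"
proof -
  have "fact (p + 1) = (real p + 1) * fact p" by simp
  moreover have "real p + 1 \<noteq> 0" by linarith
  ultimately show ?thesis
    unfolding prod_double_eq_choose choose_Suc_ratio by (simp add: divide_simps) algebra
qed

theorem proposition2p16:
  fixes n p :: nat
  assumes "n \<ge> 1"
  shows "(odd n \<and> (n + 1) div 2 \<ge> p \<and> p \<ge> 2 \<longrightarrow>
            real (F n p) =
              (\<Prod>j<p. real n + 1 - 2 * real j) * (2 * real n - 3 * real p + 3)
                / (2 ^ p * fact (p + 1))
              + real ((n + 1) choose (p + 1)))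
       \<and> (even n \<and> n div 2 \<ge> p \<and> p \<ge> 2 \<longrightarrow>
            real (F n p) =
              (\<Prod>j<p. real n - 2 * real j) * (2 * real n - real p + 3)
                / (2 ^ p * fact (p + 1))
              + real ((n + 1) choose (p + 1)))
       \<and> ((n + 1) div 2 < p \<longrightarrow> F n p = (n + 1) choose (p + 1))"
proof (intro conjI impI)
  assume a: "odd n \<and> (n + 1) div 2 \<ge> p \<and> p \<ge> 2"
  then obtain m where m: "n = 2 * m + 1" by (auto elim: oddE)
  have F_eq: "F n p = ((n + 1) choose (p + 1)) + (4 * ((m + 1) choose (p + 1)) + ((m + 1) choose p))"
    using F_closed_form[of p n] a m by simp
  have prod_eq: "(\<Prod>j<p. real n + 1 - 2 * real j) = (\<Prod>j<p. 2 * real (m + 1) - 2 * real j)"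
    by (simp add: m algebra_simps)
  have factor_eq: "2 * real n - 3 * real p + 3 = 4 * (real (m + 1) - real p) + 1 * (real p + 1)"
    by (simp add: m)
  show "real (F n p) =
      (\<Prod>j<p. real n + 1 - 2 * real j) * (2 * real n - 3 * real p + 3) / (2 ^ p * fact (p + 1))
        + real ((n + 1) choose (p + 1))"
    unfolding prod_eq factor_eq choose_combination_eq_prod F_eq by simp
next
  assume a: "even n \<and> n div 2 \<ge> p \<and> p \<ge> 2"
  then obtain m where m: "n = 2 * m" by (auto elim: evenE)
  have F_eq: "F n p = ((n + 1) choose (p + 1)) + (4 * (m choose (p + 1)) + 3 * (m choose p))"
    using F_closed_form[of p n] a m by simp
  have prod_eq: "(\<Prod>j<p. real n - 2 * real j) = (\<Prod>j<p. 2 * real m - 2 * real j)"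
    by (simp add: m)
  have factor_eq: "2 * real n - real p + 3 = 4 * (real m - real p) + 3 * (real p + 1)"
    by (simp add: m)
  show "real (F n p) =
      (\<Prod>j<p. real n - 2 * real j) * (2 * real n - real p + 3) / (2 ^ p * fact (p + 1))
        + real ((n + 1) choose (p + 1))"
    unfolding prod_eq factor_eq choose_combination_eq_prod F_eq by simp
next
  assume p: "(n + 1) div 2 < p"
  \<comment> \<open>Since \<open>n \<ge> 1\<close>, this range of \<open>p\<close> starts at \<open>2\<close>, as the closed form requires.\<close>
  then have "p \<ge> 2" using assms by linarith
  moreover have "n div 2 < p" using p by linarith
  ultimately show "F n p = (n + 1) choose (p + 1)"
    using F_closed_form[of p n] p by simp
qed

end
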